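(* Let $L$ be a frame, let $(X_L,\pi)$ be its Esakia space, and let $Y_L\subseteq X_L$ be the set of nuclear points of $X_L$. Then $L$ is spatial if and only if $Y_L$ is dense in $(X_L,\pi)$.
   Context: A frame is a complete lattice satisfying $a\wedge\bigvee S=\bigvee\{a\wedge s\mid s\in S\}$. A frame $L$ is spatial if it is isomorphic to the frame $\mathcal{O}(S)$ of open sets of some topological space $S$; equivalently, whenever $a\not\le b$ in $L$ there is a completely prime filter $x$ of $L$ with $a\in x$ and $b\notin x$. The Esakia space $X_L$ of a frame $L$ is the set of prime (proper) filters of $L$, ordered by inclusion, with the topology $\pi$ whose basis is $\{\varphi(a)\setminus\varphi(b)\mid a,b\in L\}$, where $\varphi(a)=\{x\in X_L\mid a\in x\}$. For $S\subseteq X_L$, ${\downarrow}S=\{x\in X_L\mid x\le s\text{ for some }s\in S\}$. Clopen means closed and open in $\pi$. A closed subset $F$ of $X_L$ is nuclear if for each clopen $U\subseteq X_L$ the set ${\downarrow}(U\cap F)$ is clopen. A point $y\in X_L$ is a nuclear point if $\{y\}$ is a nuclear subset. $Y_L$ denotes the set of nuclear points of $X_L$. *)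

theory Defs
  imports "HOL-Analysis.Analysis"
begin

text \<open>
  A frame is a type of class \<open>frame\<close>. The library class
  \<^class>\<open>complete_distrib_lattice\<close> requires complete distributivity, which is strictly stronger.
\<close>

class frame = complete_lattice +
  assumes inf_Sup_frame: "inf a (Sup S) = Sup ((\<lambda>s. inf a s) ` S)"

subsection \<open>Spatial frames\<close>

definition frame_iso_opens :: "('a::frame \<Rightarrow> 'b set) \<Rightarrow> 'b topology \<Rightarrow> bool" where
  "frame_iso_opens h X \<longleftrightarrow>
     bij_betw h UNIV {U. openin X U} \<and>
     h top = topspace X \<and>
     (\<forall>a b. h (inf a b) = h a \<inter> h b) \<and>
     (\<forall>A. h (Sup A) = \<Union>(h ` A))"

text \<open>
  HOL cannot quantify over the type of points of a space inside a definition, so the points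
  are taken in the type \<open>'a set\<close>. This loses nothing: by \<open>frame_iso_opens_imp_spatial\<close> below,
  a frame isomorphic to the opens of a space over any other type is spatial in this sense.
\<close>

definition spatial :: "'a::frame itself \<Rightarrow> bool" where
  "spatial _ \<longleftrightarrow> (\<exists>(X :: 'a set topology) (h :: 'a \<Rightarrow> 'a set set). frame_iso_opens h X)"

subsection \<open>The Esakia space\<close>

definition lattice_filter :: "'a::frame set \<Rightarrow> bool" where
  "lattice_filter x \<longleftrightarrow>
     x \<noteq> {} \<and> (\<forall>a b. a \<in> x \<longrightarrow> a \<le> b \<longrightarrow> b \<in> x) \<and> (\<forall>a\<in>x. \<forall>b\<in>x. inf a b \<in> x)"

definition prime_filter :: "'a::frame set \<Rightarrow> bool" where
  "prime_filter x \<longleftrightarrow>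
     lattice_filter x \<and> x \<noteq> UNIV \<and> (\<forall>a b. sup a b \<in> x \<longrightarrow> a \<in> x \<or> b \<in> x)"

definition esakia_points :: "'a::frame set set" where
  "esakia_points = {x. prime_filter x}"

definition esakia_phi :: "'a::frame \<Rightarrow> 'a set set" where
  "esakia_phi a = {x \<in> esakia_points. a \<in> x}"

definition esakia_space :: "'a::frame set topology" where
  "esakia_space = topology (arbitrary union_of (\<lambda>U. \<exists>a b. U = esakia_phi a - esakia_phi b))"

definition down :: "'a::frame set set \<Rightarrow> 'a set set" where
  "down S = {x \<in> esakia_points. \<exists>s\<in>S. x \<subseteq> s}"

definition clopenin :: "'b topology \<Rightarrow> 'b set \<Rightarrow> bool" where
  "clopenin X U \<longleftrightarrow> closedin X U \<and> openin X U"

definition nuclear :: "'a::frame set set \<Rightarrow> bool" where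
  "nuclear F \<longleftrightarrow>
     closedin esakia_space F \<and>
     (\<forall>U. clopenin esakia_space U \<longrightarrow> clopenin esakia_space (down (U \<inter> F)))"

definition nuclear_points :: "'a::frame set set" where
  "nuclear_points = {y \<in> esakia_points. nuclear {y}}"

subsection \<open>Adequacy of the definitions\<close>

text \<open>\<^const>\<open>topology\<close> is meaningful only on a family that is a topology; here it is.\<close>

lemma openin_esakia_space:
  "openin (esakia_space :: 'a::frame set topology) =
     arbitrary union_of (\<lambda>U. \<exists>a b. U = esakia_phi a - esakia_phi b)"
proof -
  have phi_inf: "esakia_phi (inf a c) = esakia_phi a \<inter> esakia_phi c" for a c :: 'a
    unfolding esakia_phi_def esakia_points_def prime_filter_def lattice_filter_def
    by (auto intro: inf.cobounded1 inf.cobounded2)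
  have phi_sup: "esakia_phi (sup b d) = esakia_phi b \<union> esakia_phi d" for b d :: 'a
    unfolding esakia_phi_def esakia_points_def prime_filter_def lattice_filter_def
    by (auto intro: sup.cobounded1 sup.cobounded2)
  have "istopology (arbitrary union_of (\<lambda>U::'a set set. \<exists>a b. U = esakia_phi a - esakia_phi b))"
  proof (rule istopology_base)
    fix S T :: "'a set set"
    assume "\<exists>a b. S = esakia_phi a - esakia_phi b" "\<exists>a b. T = esakia_phi a - esakia_phi b"
    then obtain a b c d where "S = esakia_phi a - esakia_phi b" "T = esakia_phi c - esakia_phi d"
      by blast
    then have "S \<inter> T = esakia_phi (inf a c) - esakia_phi (sup b d)"
      unfolding phi_inf phi_sup by blast
    then show "\<exists>a b. S \<inter> T = esakia_phi a - esakia_phi b" by blast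
  qed
  then show ?thesis
    unfolding esakia_space_def by (rule topology_inverse')
qed

lemma topspace_esakia_space: "topspace (esakia_space :: 'a::frame set topology) = esakia_points"
proof
  show "topspace (esakia_space :: 'a set topology) \<subseteq> esakia_points"
    unfolding topspace_def openin_esakia_space union_of_def esakia_phi_def by auto
  have mem: "top \<in> x" "bot \<notin> x" if "prime_filter x" for x :: "'a set"
    using that unfolding prime_filter_def lattice_filter_def
    by (metis all_not_in_conv top_greatest, metis UNIV_eq_I bot_least)
  have "esakia_points = esakia_phi (top::'a) - esakia_phi bot"
    using mem unfolding esakia_phi_def esakia_points_def by blast
  then have "openin (esakia_space :: 'a set topology) esakia_points"
    unfolding openin_esakia_space
    by (metis (mono_tags, lifting) arbitrary_def union_of_inc)
  then show "esakia_points \<subseteq> topspace (esakia_space :: 'a set topology)"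
    by (rule openin_subset)
qed

definition completely_prime_filter :: "'a::frame set \<Rightarrow> bool" where
  "completely_prime_filter x \<longleftrightarrow>
     lattice_filter x \<and> (\<forall>S. Sup S \<in> x \<longrightarrow> (\<exists>s\<in>S. s \<in> x))"

lemma completely_prime_separation_if_frame_iso_opens:
  fixes h :: "'a::frame \<Rightarrow> 'b set" and a b :: 'a
  assumes h: "frame_iso_opens h X" and ab: "\<not> a \<le> b"
  shows "\<exists>x. completely_prime_filter x \<and> a \<in> x \<and> b \<notin> x"
proof -
  have inj: "inj h" and inf: "\<And>a b. h (inf a b) = h a \<inter> h b"
    and Sup: "\<And>A. h (Sup A) = \<Union>(h ` A)"
    using h by (simp_all add: frame_iso_opens_def bij_betw_def)
  have mono: "h c \<subseteq> h d" if "c \<le> d" for c d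
    using inf[of c d] that by (metis inf.absorb1 inf_le2)
  have "\<not> h a \<subseteq> h b"
  proof
    assume "h a \<subseteq> h b"
    then have "h (inf a b) = h a" using inf by blast
    then have "inf a b = a" using inj by (simp add: inj_eq)
    then show False using ab by (metis inf.cobounded2)
  qed
  then obtain s where s: "s \<in> h a" "s \<notin> h b" by blast
  have "completely_prime_filter {c. s \<in> h c}"
    unfolding completely_prime_filter_def lattice_filter_def
  proof (intro conjI allI impI ballI)
    show "{c. s \<in> h c} \<noteq> {}" using s(1) by blast
    show "d \<in> {c. s \<in> h c}" if "c \<in> {c. s \<in> h c}" "c \<le> d" for c d
      using that mono[of c d] by blast
    show "inf c d \<in> {c. s \<in> h c}" if "c \<in> {c. s \<in> h c}" "d \<in> {c. s \<in> h c}" for c d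
      using that by (simp add: inf)
    show "\<exists>c\<in>S. c \<in> {c. s \<in> h c}" if "Sup S \<in> {c. s \<in> h c}" for S
      using that by (simp add: Sup)
  qed
  then show ?thesis using s by blast
qed

lemma spatial_iff_completely_prime_separation:
  "spatial TYPE('a::frame) \<longleftrightarrow>
     (\<forall>a b :: 'a. \<not> a \<le> b \<longrightarrow> (\<exists>x. completely_prime_filter x \<and> a \<in> x \<and> b \<notin> x))"
proof
  assume "spatial TYPE('a)"
  then obtain X and h :: "'a \<Rightarrow> 'a set set" where "frame_iso_opens h X"
    unfolding spatial_def by blast
  then show "\<forall>a b :: 'a. \<not> a \<le> b \<longrightarrow> (\<exists>x. completely_prime_filter x \<and> a \<in> x \<and> b \<notin> x)"
    by (blast intro: completely_prime_separation_if_frame_iso_opens)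
next
  assume sep: "\<forall>a b :: 'a. \<not> a \<le> b \<longrightarrow> (\<exists>x. completely_prime_filter x \<and> a \<in> x \<and> b \<notin> x)"
  define h where "h a = {x. completely_prime_filter x \<and> a \<in> x}" for a :: 'a
  have up: "b \<in> x" if "completely_prime_filter x" "a \<in> x" "a \<le> b" for a b :: 'a and x
    using that unfolding completely_prime_filter_def lattice_filter_def by blast
  have inf: "h (inf a b) = h a \<inter> h b" for a b
  proof -
    have "inf a b \<in> x \<longleftrightarrow> a \<in> x \<and> b \<in> x" if x: "completely_prime_filter x" for x
      using up[OF x _ inf.cobounded1] up[OF x _ inf.cobounded2] x
      unfolding completely_prime_filter_def lattice_filter_def by blast
    then show ?thesis unfolding h_def by blast
  qed
  have Sup: "h (Sup A) = \<Union>(h ` A)" for A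
  proof -
    have "Sup A \<in> x \<longleftrightarrow> (\<exists>a\<in>A. a \<in> x)" if x: "completely_prime_filter x" for x
      using up[OF x _ Sup_upper] x unfolding completely_prime_filter_def by blast
    then show ?thesis unfolding h_def by blast
  qed
  have le: "a \<le> b" if "h a \<subseteq> h b" for a b
    using sep that unfolding h_def by blast
  have "inj h" by (rule injI) (simp add: le order.antisym)
  have "istopology (\<lambda>U. U \<in> range h)"
    unfolding istopology_def
  proof (intro conjI allI impI)
    fix S T assume "S \<in> range h" "T \<in> range h"
    then obtain a b where "S = h a" "T = h b" by blast
    then show "S \<inter> T \<in> range h" using inf[of a b] by (simp add: image_iff) metis
  next
    fix K assume "\<forall>U\<in>K. U \<in> range h"
    then have "K \<subseteq> range h" by blast
    then obtain A where "K = h ` A" by (metis subset_imageE)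
    then show "\<Union>K \<in> range h" using Sup by (metis rangeI)
  qed
  then have op: "openin (topology (\<lambda>U. U \<in> range h)) = (\<lambda>U. U \<in> range h)"
    by (rule topology_inverse')
  have "h a \<subseteq> h top" for a unfolding h_def using up[OF _ _ top_greatest] by blast
  then have "topspace (topology (\<lambda>U. U \<in> range h)) = h top"
    unfolding topspace_def op by blast
  then have "frame_iso_opens h (topology (\<lambda>U. U \<in> range h))"
    unfolding frame_iso_opens_def op using \<open>inj h\<close> inf Sup by (simp add: bij_betw_def)
  then show "spatial TYPE('a)" unfolding spatial_def by blast
qed

lemma frame_iso_opens_imp_spatial:
  fixes h :: "'a::frame \<Rightarrow> 'b set"
  assumes "frame_iso_opens h X"
  shows "spatial TYPE('a)"
  unfolding spatial_iff_completely_prime_separation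
  using completely_prime_separation_if_frame_iso_opens[OF assms] by blast

end

theory Submission
  imports Defs
begin

text \<open>
  The nuclear points are exactly the completely prime filters, so density of
  the nuclear points says that every nonempty basic open set
  \<open>esakia_phi a - esakia_phi b\<close> contains a completely prime filter. By the prime filter theorem
  such a set is nonempty iff \<open>\<not> a \<le> b\<close>, and the claim becomes the separation criterion
  for spatiality.

  Since points are closed, \<open>y\<close> is nuclear iff its principal downset is clopen. For \<open>y\<close> completely
  prime and \<open>b = Sup (- y)\<close>, this downset is the complement of \<open>esakia_phi b\<close>. Conversely,
  if the downset is open, it contains some \<open>esakia_phi c - esakia_phi d\<close> around \<open>y\<close>; then
  \<open>inf c s \<le> d\<close> for every \<open>s \<notin> y\<close>, and the frame law gives
  \<open>inf c (Sup S) \<le> d\<close> whenever \<open>S\<close> misses \<open>y\<close>, so \<open>Sup S \<notin> y\<close>.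
\<close>

section \<open>Filters and the prime filter theorem\<close>

lemma inf_sup_distrib_frame: "inf a (sup b c) = sup (inf a b) (inf a c)" for a b c :: "'a::frame"
  using inf_Sup_frame[of a "{b, c}"] by simp

lemma lattice_filter_up: "lattice_filter x \<Longrightarrow> a \<in> x \<Longrightarrow> a \<le> b \<Longrightarrow> b \<in> x"
  unfolding lattice_filter_def by blast

lemma lattice_filter_inf: "lattice_filter x \<Longrightarrow> a \<in> x \<Longrightarrow> b \<in> x \<Longrightarrow> inf a b \<in> x"
  unfolding lattice_filter_def by blast

lemma lattice_filter_top: "lattice_filter x \<Longrightarrow> top \<in> x"
  unfolding lattice_filter_def by (metis all_not_in_conv top_greatest)

lemma prime_filter_imp_lattice_filter: "prime_filter x \<Longrightarrow> lattice_filter x"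
  unfolding prime_filter_def by blast

lemma prime_filter_bot: "prime_filter x \<Longrightarrow> bot \<notin> x"
  unfolding prime_filter_def using lattice_filter_up[OF _ _ bot_least] by blast

lemma lattice_filter_principal: "lattice_filter {a..}"
  unfolding lattice_filter_def by (auto intro: order_trans)

text \<open>Provides the upper bounds for Zorn's lemma. Two elements of the union already lie in a
  common member, because members of a chain are comparable.\<close>

lemma lattice_filter_Union_chain:
  assumes "subset.chain A C" "C \<noteq> {}" "\<And>x. x \<in> C \<Longrightarrow> lattice_filter x"
  shows "lattice_filter (\<Union>C)"
  unfolding lattice_filter_def
proof (intro conjI allI impI ballI)
  show "\<Union>C \<noteq> {}" using assms(2,3) lattice_filter_top by blast
  show "b \<in> \<Union>C" if "a \<in> \<Union>C" "a \<le> b" for a b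
    using that assms(3) lattice_filter_up by blast
  fix a b assume "a \<in> \<Union>C" "b \<in> \<Union>C"
  then obtain x y where xy: "x \<in> C" "a \<in> x" "y \<in> C" "b \<in> y" by blast
  then have "x \<subseteq> y \<or> y \<subseteq> x" using assms(1) unfolding subset_chain_def by blast
  then show "inf a b \<in> \<Union>C" using xy assms(3) lattice_filter_inf by blast
qed

text \<open>The set is the filter generated by \<open>x\<close> and \<open>c\<close>; enlarging a
  maximal filter by it yields a contradiction.\<close>

lemma lattice_filter_extend:
  assumes "lattice_filter x"
  shows "lattice_filter {z. \<exists>f\<in>x. inf f c \<le> z}"
  unfolding lattice_filter_def
proof (intro conjI allI impI ballI)
  show "{z. \<exists>f\<in>x. inf f c \<le> z} \<noteq> {}" using lattice_filter_top[OF assms] by blast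
  show "b \<in> {z. \<exists>f\<in>x. inf f c \<le> z}" if "a \<in> {z. \<exists>f\<in>x. inf f c \<le> z}" "a \<le> b" for a b
    using that by (auto intro: order_trans)
  fix a b assume "a \<in> {z. \<exists>f\<in>x. inf f c \<le> z}" "b \<in> {z. \<exists>f\<in>x. inf f c \<le> z}"
  then obtain f g where fg: "f \<in> x" "g \<in> x" "inf f c \<le> a" "inf g c \<le> b" by blast
  have "inf (inf f g) c \<le> inf a b"
    using order_trans[OF inf_mono[OF inf_le1 order_refl] fg(3)]
      order_trans[OF inf_mono[OF inf_le2 order_refl] fg(4)] by (rule le_infI)
  then show "inf a b \<in> {z. \<exists>f\<in>x. inf f c \<le> z}"
    using lattice_filter_inf[OF assms fg(1,2)] by blast
qed

text \<open>Zorn's lemma gives a filter maximal among those containing \<open>a\<close> and missing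
  \<open>b\<close>; distributivity makes it prime.\<close>

theorem prime_filter_separation:
  fixes a b :: "'a::frame"
  assumes "\<not> a \<le> b"
  obtains x where "prime_filter x" "a \<in> x" "b \<notin> x"
proof -
  let ?A = "{x. lattice_filter x \<and> a \<in> x \<and> b \<notin> x}"
  have "{a..} \<in> ?A" using assms lattice_filter_principal by auto
  moreover have "\<Union>C \<in> ?A" if "C \<noteq> {}" "subset.chain ?A C" for C
  proof -
    have "C \<subseteq> ?A" using that(2) unfolding subset_chain_def by blast
    then show ?thesis using lattice_filter_Union_chain[OF that(2,1)] that(1) by blast
  qed
  ultimately obtain x where x: "x \<in> ?A" and max: "\<forall>y\<in>?A. x \<subseteq> y \<longrightarrow> y = x"
    using subset_Zorn_nonempty[of ?A] by blast
  have filt: "lattice_filter x" using x by blast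
  \<comment> \<open>By maximality, the filter generated by \<open>x\<close> and an outside element
    \<open>c\<close> must contain \<open>b\<close>.\<close>
  have ext: "\<exists>f\<in>x. inf f c \<le> b" if "c \<notin> x" for c
  proof (rule ccontr)
    let ?F = "{z. \<exists>f\<in>x. inf f c \<le> z}"
    assume "\<not> ?thesis"
    moreover have "x \<subseteq> ?F" by (auto intro: le_infI1)
    ultimately have "?F = x" using max x lattice_filter_extend[OF filt] by blast
    moreover have "c \<in> ?F" using lattice_filter_top[OF filt] by (auto intro: le_infI2)
    ultimately show False using that by blast
  qed
  have "prime_filter x"
    unfolding prime_filter_def
  proof (intro conjI allI impI)
    show "lattice_filter x" by (rule filt)
    show "x \<noteq> UNIV" using x by blast
    fix c d assume cd: "sup c d \<in> x"
    show "c \<in> x \<or> d \<in> x"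
    proof (rule ccontr)
      assume "\<not> ?thesis"
      then obtain f g where fg: "f \<in> x" "g \<in> x" "inf f c \<le> b" "inf g d \<le> b"
        using ext by blast
      \<comment> \<open>The common witness \<open>inf f g\<close> works for \<open>c\<close> and
        \<open>d\<close> at once, so distributivity carries the bound over to
        \<open>sup c d\<close>.\<close>
      have "inf (inf f g) c \<le> b" "inf (inf f g) d \<le> b"
        using order_trans[OF inf_mono[OF inf_le1 order_refl] fg(3)]
          order_trans[OF inf_mono[OF inf_le2 order_refl] fg(4)] by blast+
      then have "inf (inf f g) (sup c d) \<le> b" by (simp add: inf_sup_distrib_frame)
      moreover have "inf (inf f g) (sup c d) \<in> x"
        using fg(1,2) cd lattice_filter_inf[OF filt] by blast
      ultimately show False using x lattice_filter_up[OF filt] by blast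
    qed
  qed
  then show thesis using that x by blast
qed

text \<open>Properness and primeness are the cases of the empty and the two-element set, since
  \<open>bot\<close> and \<open>sup a b\<close> are their suprema.\<close>

lemma completely_prime_filter_imp_prime_filter:
  assumes "completely_prime_filter x"
  shows "prime_filter x"
proof -
  have Sup: "\<exists>s\<in>S. s \<in> x" if "Sup S \<in> x" for S
    using assms that unfolding completely_prime_filter_def by blast
  have "bot \<notin> x" using Sup[of "{}"] by auto
  moreover have "a \<in> x \<or> b \<in> x" if "sup a b \<in> x" for a b
    using Sup[of "{a, b}"] that by auto
  ultimately show ?thesis
    using assms unfolding prime_filter_def completely_prime_filter_def by blast
qed

section \<open>Open and clopen sets of the Esakia space\<close>

lemma openin_esakia_space_iff:
  "openin esakia_space U \<longleftrightarrow>
    (\<forall>x\<in>U. \<exists>a b. x \<in> esakia_phi a - esakia_phi b \<and> esakia_phi a - esakia_phi b \<subseteq> U)"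
  unfolding openin_esakia_space arbitrary_union_of_alt by blast

lemma openin_esakia_basic: "openin esakia_space (esakia_phi a - esakia_phi b)"
  unfolding openin_esakia_space_iff by blast

lemma esakia_phi_top: "esakia_phi top = esakia_points"
  unfolding esakia_phi_def esakia_points_def
  using lattice_filter_top prime_filter_imp_lattice_filter by blast

lemma esakia_phi_bot: "esakia_phi bot = {}"
  unfolding esakia_phi_def esakia_points_def using prime_filter_bot by blast

lemma clopenin_esakia_phi_compl: "clopenin esakia_space (esakia_points - esakia_phi a)"
proof -
  have "openin esakia_space (esakia_phi a)"
    using openin_esakia_basic[of a bot] by (simp add: esakia_phi_bot)
  moreover have "openin esakia_space (esakia_points - esakia_phi a)"
    using openin_esakia_basic[of top a] by (simp add: esakia_phi_top)
  ultimately show ?thesis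
    unfolding clopenin_def by (metis openin_closedin_eq topspace_esakia_space)
qed

text \<open>Distinct points differ in some element \<open>a\<close>, and both
  \<open>esakia_phi a\<close> and its complement are basic open sets.\<close>

lemma closedin_esakia_singleton:
  assumes "y \<in> esakia_points"
  shows "closedin esakia_space {y}"
proof -
  have "openin esakia_space (esakia_points - {y})"
    unfolding openin_esakia_space_iff
  proof
    fix x assume x: "x \<in> esakia_points - {y}"
    then consider a where "a \<in> x" "a \<notin> y" | a where "a \<in> y" "a \<notin> x" by blast
    then show "\<exists>a b. x \<in> esakia_phi a - esakia_phi b \<and>
        esakia_phi a - esakia_phi b \<subseteq> esakia_points - {y}"
    proof cases
      case 1
      then have "x \<in> esakia_phi a - esakia_phi bot"
        "esakia_phi a - esakia_phi bot \<subseteq> esakia_points - {y}"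
        using x unfolding esakia_phi_bot by (auto simp: esakia_phi_def)
      then show ?thesis by blast
    next
      case 2
      then have "x \<in> esakia_phi top - esakia_phi a"
        "esakia_phi top - esakia_phi a \<subseteq> esakia_points - {y}"
        using x assms unfolding esakia_phi_top by (auto simp: esakia_phi_def)
      then show ?thesis by blast
    qed
  qed
  then show ?thesis using assms by (simp add: closedin_def topspace_esakia_space)
qed

text \<open>For clopen \<open>U\<close>, the set \<open>U \<inter> {y}\<close> is \<open>{y}\<close>
  or empty, and the downset of the empty set is empty. The choice \<open>U = esakia_points\<close>
  gives the forward direction.\<close>

lemma nuclear_singleton_iff:
  assumes "y \<in> esakia_points"
  shows "nuclear {y} \<longleftrightarrow> clopenin esakia_space (down {y})"
proof
  have "clopenin esakia_space esakia_points"
    unfolding clopenin_def by (metis closedin_topspace openin_topspace topspace_esakia_space)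
  then show "clopenin esakia_space (down {y})" if "nuclear {y}"
    using that assms unfolding nuclear_def by (metis Int_insert_right_if1 Int_empty_right)
next
  assume down: "clopenin esakia_space (down {y})"
  have "clopenin esakia_space (down (U \<inter> {y}))" for U
  proof (cases "y \<in> U")
    case True
    then show ?thesis using down by simp
  next
    case False
    then show ?thesis by (simp add: down_def clopenin_def)
  qed
  then show "nuclear {y}" unfolding nuclear_def using closedin_esakia_singleton[OF assms] by blast
qed

section \<open>Nuclear points as completely prime filters\<close>

lemma completely_prime_filter_if_openin_down:
  fixes y :: "'a::frame set"
  assumes y: "prime_filter y" and down: "openin esakia_space (down {y})"
  shows "completely_prime_filter y"
proof -
  have filt: "lattice_filter y" using y by (rule prime_filter_imp_lattice_filter)
  have "y \<in> down {y}" using y unfolding down_def esakia_points_def by blast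
  then obtain c d where cd: "y \<in> esakia_phi c - esakia_phi d"
      "esakia_phi c - esakia_phi d \<subseteq> down {y}"
    using down unfolding openin_esakia_space_iff by blast
  then have c: "c \<in> y" and d: "d \<notin> y" unfolding esakia_phi_def by blast+
  \<comment> \<open>A prime filter containing \<open>inf c s\<close> but not \<open>d\<close> would
    lie in the chosen neighbourhood, hence inside \<open>y\<close>, and would put \<open>s\<close>
    into \<open>y\<close>.\<close>
  have le: "inf c s \<le> d" if s: "s \<notin> y" for s
  proof (rule ccontr)
    assume "\<not> inf c s \<le> d"
    then obtain x where x: "prime_filter x" "inf c s \<in> x" "d \<notin> x"
      using prime_filter_separation by blast
    then have "c \<in> x" "s \<in> x"
      using lattice_filter_up[OF prime_filter_imp_lattice_filter[OF x(1)] x(2)] by simp_all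
    then have "x \<in> down {y}"
      using x cd(2) unfolding esakia_phi_def esakia_points_def by blast
    then show False using \<open>s \<in> x\<close> s unfolding down_def by blast
  qed
  have "\<exists>s\<in>S. s \<in> y" if "Sup S \<in> y" for S
  proof (rule ccontr)
    assume "\<not> ?thesis"
    then have "inf c (Sup S) \<le> d"
      unfolding inf_Sup_frame using le by (auto intro: Sup_least)
    then show False
      using lattice_filter_up[OF filt] lattice_filter_inf[OF filt c that] d by blast
  qed
  then show ?thesis unfolding completely_prime_filter_def using filt by blast
qed

lemma clopenin_down_if_completely_prime_filter:
  fixes y :: "'a::frame set"
  assumes "completely_prime_filter y"
  shows "clopenin esakia_space (down {y})"
proof -
  \<comment> \<open>Complete primeness keeps this supremum outside \<open>y\<close>, so it is the
    largest element not in \<open>y\<close>; a prime filter leaves \<open>y\<close> exactly when it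
    contains it.\<close>
  let ?b = "Sup (- y)"
  have b: "?b \<notin> y" using assms unfolding completely_prime_filter_def by blast
  have "x \<subseteq> y \<longleftrightarrow> ?b \<notin> x" if "prime_filter x" for x
  proof
    show "?b \<notin> x" if "x \<subseteq> y" using that b by blast
    assume "?b \<notin> x"
    then show "x \<subseteq> y"
      using lattice_filter_up[OF prime_filter_imp_lattice_filter[OF that] _ Sup_upper] by blast
  qed
  then have "down {y} = esakia_points - esakia_phi ?b"
    unfolding down_def esakia_phi_def esakia_points_def by blast
  then show ?thesis using clopenin_esakia_phi_compl by simp
qed

lemma nuclear_points_eq: "nuclear_points = {x. completely_prime_filter x}"
proof -
  have "y \<in> nuclear_points \<longleftrightarrow> completely_prime_filter y" for y :: "'a set"
    unfolding nuclear_points_def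
    using nuclear_singleton_iff[of y] completely_prime_filter_if_openin_down[of y]
      clopenin_down_if_completely_prime_filter[of y] completely_prime_filter_imp_prime_filter[of y]
    by (auto simp: esakia_points_def clopenin_def)
  then show ?thesis by blast
qed

section \<open>Density in terms of the frame order\<close>

lemma esakia_basic_nonempty_iff:
  fixes a b :: "'a::frame"
  shows "esakia_phi a - esakia_phi b \<noteq> {} \<longleftrightarrow> \<not> a \<le> b"
proof
  show "\<not> a \<le> b" if "esakia_phi a - esakia_phi b \<noteq> {}"
    using that lattice_filter_up[OF prime_filter_imp_lattice_filter]
    unfolding esakia_phi_def esakia_points_def by blast
  show "esakia_phi a - esakia_phi b \<noteq> {}" if "\<not> a \<le> b"
    using prime_filter_separation[OF that] unfolding esakia_phi_def esakia_points_def by blast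
qed

text \<open>Density need only be tested on nonempty basic open sets, and
  \<open>esakia_basic_nonempty_iff\<close> identifies these.\<close>

lemma esakia_dense_iff:
  fixes D :: "'a::frame set set"
  shows "esakia_space closure_of D = topspace esakia_space \<longleftrightarrow>
    (\<forall>a b. \<not> a \<le> b \<longrightarrow> D \<inter> (esakia_phi a - esakia_phi b) \<noteq> {})"
  unfolding dense_intersects_open
proof (intro iffI allI impI)
  fix a b :: 'a
  assume "\<forall>T. openin esakia_space T \<and> T \<noteq> {} \<longrightarrow> D \<inter> T \<noteq> {}" "\<not> a \<le> b"
  then show "D \<inter> (esakia_phi a - esakia_phi b) \<noteq> {}"
    using openin_esakia_basic[of a b] esakia_basic_nonempty_iff[of a b] by blast
next
  fix T :: "'a set set"
  assume D: "\<forall>a b. \<not> a \<le> b \<longrightarrow> D \<inter> (esakia_phi a - esakia_phi b) \<noteq> {}"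
    and "openin esakia_space T \<and> T \<noteq> {}"
  then obtain a b where ab: "esakia_phi a - esakia_phi b \<noteq> {}" "esakia_phi a - esakia_phi b \<subseteq> T"
    unfolding openin_esakia_space_iff by blast
  then have "D \<inter> (esakia_phi a - esakia_phi b) \<noteq> {}"
    using D esakia_basic_nonempty_iff[of a b] by simp
  then show "D \<inter> T \<noteq> {}" using ab(2) by blast
qed

theorem theorem5p5:
  shows "spatial TYPE('a::frame) \<longleftrightarrow>
    (esakia_space :: 'a set topology) closure_of nuclear_points = topspace esakia_space"
proof -
  have "nuclear_points \<inter> (esakia_phi a - esakia_phi b) \<noteq> {} \<longleftrightarrow>
      (\<exists>x. completely_prime_filter x \<and> a \<in> x \<and> b \<notin> x)" for a b :: 'a
    unfolding nuclear_points_eq esakia_phi_def esakia_points_def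
    using completely_prime_filter_imp_prime_filter by blast
  then show ?thesis
    unfolding spatial_iff_completely_prime_separation esakia_dense_iff by simp
qed

end
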